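(* Let $L$ be a Latin square of order $n$. If $\gamma_3(L_3(L,n))=n$, then \[ d_3(L_3(L,n))\geq d_{(1,3)}(L_3(L,n))=\tau(L). \]
   Context: A Latin square of order $n$ is an $n\times n$ array $L=(\ell_{i,j})$ with entries from $[n]$ such that no symbol appears twice in any row or column. A transversal in $L$ is a set of cells containing exactly one cell from each row, one from each column, and one cell of each symbol; $\tau(L)$ is the maximum number of pairwise disjoint transversals in $L$. The Latin square graph $L_3(L,n)$ has vertex set $\{(i,j)\mid 1\le i,j\le n\}$, with distinct $(i,j),(p,q)$ adjacent iff $i=p$ or $j=q$ or $\ell_{i,j}=\ell_{p,q}$. A set $S$ of vertices of a graph $G$ is $k$-dominating if every vertex outside $S$ has at least $k$ neighbours in $S$; $\gamma_k(G)$ is the minimum size of a $k$-dominating set. The $k$-domatic number $d_k(G)$ is the maximum number of sets in a partition of $V(G)$ into $k$-dominating sets. A $(1,3)$-independent dominating set is an independent $3$-dominating set, and the $(1,3)$-independent domatic number $d_{(1,3)}(G)$ is the maximum number of sets in a partition of $V(G)$ into $(1,3)$-independent dominating sets.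
   Formalization: d_{(1,3)} is taken as the maximum number of pairwise disjoint (1,3)-independent dominating sets, since a partition of V(G) into such sets may fail to exist (some order 5 squares); with the partition definition, the claim is also proved whenever such a partition exists. *)

theory Defs
  imports Complex_Main "HOL-Library.Disjoint_Sets"
begin

text \<open>A simple graph is a pair of a vertex set and a set of two-element sets of vertices.\<close>

type_synonym 'a sgraph = "'a set \<times> 'a set set"

abbreviation verts :: "'a sgraph \<Rightarrow> 'a set" where "verts G \<equiv> fst G"
abbreviation edges :: "'a sgraph \<Rightarrow> 'a set set" where "edges G \<equiv> snd G"

definition independent_set :: "'a sgraph \<Rightarrow> 'a set \<Rightarrow> bool" where
  "independent_set G S \<longleftrightarrow> S \<subseteq> verts G \<and> (\<forall>u\<in>S. \<forall>v\<in>S. {u, v} \<notin> edges G)"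

definition k_dominating :: "nat \<Rightarrow> 'a sgraph \<Rightarrow> 'a set \<Rightarrow> bool" where
  "k_dominating k G S \<longleftrightarrow>
     S \<subseteq> verts G \<and> (\<forall>v \<in> verts G - S. k \<le> card {u \<in> S. {u, v} \<in> edges G})"

definition k_domination_number :: "nat \<Rightarrow> 'a sgraph \<Rightarrow> nat" where
  "k_domination_number k G = Min {card S | S. k_dominating k G S}"

definition k_domatic_number :: "nat \<Rightarrow> 'a sgraph \<Rightarrow> nat" where
  "k_domatic_number k G =
     Max {card P | P. partition_on (verts G) P \<and> (\<forall>S\<in>P. k_dominating k G S)}"

definition indep_k_dominating :: "nat \<Rightarrow> 'a sgraph \<Rightarrow> 'a set \<Rightarrow> bool" where
  "indep_k_dominating k G S \<longleftrightarrow> independent_set G S \<and> k_dominating k G S"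

definition indep_domatic_partition :: "nat \<Rightarrow> 'a sgraph \<Rightarrow> 'a set set \<Rightarrow> bool" where
  "indep_domatic_partition k G P \<longleftrightarrow>
     partition_on (verts G) P \<and> (\<forall>S\<in>P. indep_k_dominating k G S)"

text \<open>The \<open>(1,k)\<close>-independent domatic number in terms of genuine partitions of the vertex set.
  Unlike in the case of k-dominating sets, a graph need not have any such partition, and then this
  maximum is undefined (\<open>Max {}\<close>); use it only under the assumption that a partition exists.\<close>

definition indep_domatic_number_part :: "nat \<Rightarrow> 'a sgraph \<Rightarrow> nat" where
  "indep_domatic_number_part k G = Max {card P | P. indep_domatic_partition k G P}"

text \<open>The \<open>(1,k)\<close>-independent domatic number for arbitrary graphs: the maximum number of pairwise
  disjoint independent k-dominating sets, vertices outside these sets being allowed. For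
  k-dominating sets the leftover vertices can be added to any one of the sets, so that counting
  disjoint sets and counting parts of a partition agree; for independent ones they cannot.\<close>

definition indep_domatic_number :: "nat \<Rightarrow> 'a sgraph \<Rightarrow> nat" where
  "indep_domatic_number k G =
     Max {card P | P. disjoint P \<and> (\<forall>S\<in>P. indep_k_dominating k G S)}"

text \<open>Only the values \<open>L i j\<close> with \<open>i\<close> and \<open>j\<close> in \<open>{1..n}\<close> are relevant.\<close>

definition latin_square :: "nat \<Rightarrow> (nat \<Rightarrow> nat \<Rightarrow> nat) \<Rightarrow> bool" where
  "latin_square n L \<longleftrightarrow>
     (\<forall>i\<in>{1..n}. \<forall>j\<in>{1..n}. L i j \<in> {1..n}) \<and>
     (\<forall>i\<in>{1..n}. inj_on (\<lambda>j. L i j) {1..n}) \<and>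
     (\<forall>j\<in>{1..n}. inj_on (\<lambda>i. L i j) {1..n})"

definition transversal :: "nat \<Rightarrow> (nat \<Rightarrow> nat \<Rightarrow> nat) \<Rightarrow> (nat \<times> nat) set \<Rightarrow> bool" where
  "transversal n L T \<longleftrightarrow>
     T \<subseteq> {1..n} \<times> {1..n} \<and>
     (\<forall>i\<in>{1..n}. \<exists>!c. c \<in> T \<and> fst c = i) \<and>
     (\<forall>j\<in>{1..n}. \<exists>!c. c \<in> T \<and> snd c = j) \<and>
     (\<forall>s\<in>{1..n}. \<exists>!c. c \<in> T \<and> L (fst c) (snd c) = s)"

definition max_disjoint_transversals :: "nat \<Rightarrow> (nat \<Rightarrow> nat \<Rightarrow> nat) \<Rightarrow> nat" where
  "max_disjoint_transversals n L =
     Max {card P | P. disjoint P \<and> (\<forall>T\<in>P. transversal n L T)}"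

definition latin_square_graph :: "(nat \<Rightarrow> nat \<Rightarrow> nat) \<Rightarrow> nat \<Rightarrow> (nat \<times> nat) sgraph" where
  "latin_square_graph L n =
     ({1..n} \<times> {1..n},
      {{(i, j), (p, q)} | i j p q.
         (i, j) \<in> {1..n} \<times> {1..n} \<and> (p, q) \<in> {1..n} \<times> {1..n} \<and> (i, j) \<noteq> (p, q) \<and>
         (i = p \<or> j = q \<or> L i j = L p q)})"

end

theory Submission
  imports Defs
begin

text \<open>An independent set of the Latin square graph meets each row, each column and each symbol at
  most once, hence has at most \<open>n\<close> cells. If it is also 3-dominating, \<open>\<gamma>\<^sub>3 = n\<close> forces exactly \<open>n\<close> cells,
  so it is a transversal. Conversely a transversal is independent, and a cell outside it has three
  distinct neighbours in it: those sharing its row, its column and its symbol. For \<open>d\<^sub>3\<close>, cells left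
  over by a disjoint family are added to one of its members.\<close>

section \<open>Unique fibres as bijections, and counting in disjoint families\<close>

lemma ex1_fibre_iff_bij_betw:
  assumes "f ` S \<subseteq> A"
  shows "(\<forall>a\<in>A. \<exists>!c. c \<in> S \<and> f c = a) \<longleftrightarrow> bij_betw f S A"
proof
  assume *: "\<forall>a\<in>A. \<exists>!c. c \<in> S \<and> f c = a"
  have "inj_on f S"
  proof (rule inj_onI)
    fix x y assume "x \<in> S" "y \<in> S" "f x = f y"
    moreover from this assms have "f x \<in> A" by auto
    ultimately show "x = y" using * by metis
  qed
  moreover have "A \<subseteq> f ` S" using * by blast
  ultimately show "bij_betw f S A" using assms by (auto simp: bij_betw_def)
next
  assume "bij_betw f S A"
  then show "\<forall>a\<in>A. \<exists>!c. c \<in> S \<and> f c = a"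
    by (auto simp: bij_betw_def inj_on_def)
qed

lemma card_disjoint_uniform:
  assumes "disjoint P" "\<And>S. S \<in> P \<Longrightarrow> finite S \<and> card S = m"
  shows "card (\<Union>P) = card P * m"
  using card_Union_disjoint[of P] assms by (simp add: disjoint_def)

section \<open>Dominating sets and domatic numbers of finite graphs\<close>

lemma k_dominating_mono:
  assumes "k_dominating k G S" "S \<subseteq> T" "T \<subseteq> verts G" "finite T"
  shows "k_dominating k G T"
  unfolding k_dominating_def
proof (intro conjI ballI)
  fix v assume "v \<in> verts G - T"
  then have "k \<le> card {u \<in> S. {u, v} \<in> edges G}"
    using assms(1,2) by (auto simp: k_dominating_def)
  \<comment> \<open>Finiteness of \<open>T\<close> matters here: an infinite set of neighbours would
    have \<open>card\<close> 0.\<close>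
  also have "\<dots> \<le> card {u \<in> T. {u, v} \<in> edges G}"
    using assms(2,4) by (intro card_mono) auto
  finally show "k \<le> card {u \<in> T. {u, v} \<in> edges G}" .
qed (use assms in auto)

lemma k_domination_number_le:
  assumes "finite (verts G)" "k_dominating k G S"
  shows "k_domination_number k G \<le> card S"
proof -
  have "{S. k_dominating k G S} \<subseteq> Pow (verts G)"
    by (auto simp: k_dominating_def)
  then have "finite {S. k_dominating k G S}"
    using assms(1) by (meson finite_Pow_iff finite_subset)
  then have "finite {card S | S. k_dominating k G S}" by simp
  then show ?thesis
    unfolding k_domination_number_def using assms(2) by (intro Min_le) auto
qed

text \<open>\<open>Max\<close> is meaningful only on finite sets. All members live in the finite set
  \<open>V\<close>, so there are only finitely many families; this serves the maxima that are
  bounded or evaluated below.\<close>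

lemma finite_card_families:
  assumes "finite V" "\<And>P S. Q P \<Longrightarrow> S \<in> P \<Longrightarrow> S \<subseteq> V"
  shows "finite {card P | P. Q P}"
proof -
  have "{P. Q P} \<subseteq> Pow (Pow V)" using assms(2) by blast
  then have "finite {P. Q P}"
    using assms(1) by (meson finite_Pow_iff finite_subset)
  then show ?thesis by simp
qed

lemma card_le_k_domatic_number:
  assumes "finite (verts G)" "partition_on (verts G) P" "\<forall>S\<in>P. k_dominating k G S"
  shows "card P \<le> k_domatic_number k G"
  unfolding k_domatic_number_def
  using assms by (intro Max_ge finite_card_families[OF assms(1)]) (auto simp: k_dominating_def)

text \<open>A nonempty family becomes a partition of the same size once one member absorbs the
  uncovered vertices, since supersets stay k-dominating. A partition has no empty part;
  \<open>k \<ge> 1\<close> and a nonempty vertex set rule out the empty set as a k-dominating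
  set.\<close>

lemma disjoint_card_le_k_domatic_number:
  assumes fin: "finite (verts G)" and ne: "verts G \<noteq> {}" and "k \<ge> 1"
    and disj: "disjoint P" and dom: "\<forall>S\<in>P. k_dominating k G S"
  shows "card P \<le> k_domatic_number k G"
proof (cases "P = {}")
  case False
  then obtain S where "S \<in> P" by blast
  have sub: "\<Union>P \<subseteq> verts G" using dom by (auto simp: k_dominating_def)
  have finP: "finite P"
    using sub fin by (meson finite_UnionD finite_subset)
  \<comment> \<open>By disjointness, \<open>S'\<close> is \<open>S\<close> plus the vertices that no
    member of \<open>P\<close> covers.\<close>
  define S' where "S' = verts G - \<Union>(P - {S})"
  define Q where "Q = insert S' (P - {S})"
  have "{} \<notin> P" using dom ne \<open>k \<ge> 1\<close> by (auto simp: k_dominating_def)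
  have "S \<subseteq> S'"
    using disj \<open>S \<in> P\<close> sub unfolding S'_def disjoint_def by blast
  have "S' \<noteq> {}" using \<open>S \<subseteq> S'\<close> \<open>S \<in> P\<close> \<open>{} \<notin> P\<close> by auto
  \<comment> \<open>\<open>S'\<close> misses every other member, so being nonempty it equals none of
    them; exchanging \<open>S\<close> for \<open>S'\<close> keeps the number of sets.\<close>
  have "S' \<notin> P - {S}" using \<open>S' \<noteq> {}\<close> unfolding S'_def by blast
  then have "card Q = card P"
    using finP \<open>S \<in> P\<close> unfolding Q_def by (metis card_insert_disjoint card.remove finite_Diff)
  have "S' \<subseteq> verts G" unfolding S'_def by (rule Diff_subset)
  then have "k_dominating k G S'"
    using dom \<open>S \<in> P\<close> \<open>S \<subseteq> S'\<close> fin k_dominating_mono finite_subset by metis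
  moreover have "partition_on (verts G) Q"
  proof (rule partition_onI)
    show "\<Union>Q = verts G" using sub unfolding Q_def S'_def by blast
    show "{} \<notin> Q" using \<open>S' \<noteq> {}\<close> \<open>{} \<notin> P\<close> by (simp add: Q_def)
    show "disjnt p q" if "p \<in> Q" "q \<in> Q" "p \<noteq> q" for p q
    proof -
      have "disjnt S' r" "disjnt r S'" if "r \<in> P - {S}" for r
        using that by (auto simp: S'_def disjnt_def)
      with that disj show ?thesis
        unfolding Q_def disjoint_def disjnt_def by (metis DiffD1 insertE)
    qed
  qed
  ultimately have "card Q \<le> k_domatic_number k G"
    using dom fin by (intro card_le_k_domatic_number) (auto simp: Q_def)
  with \<open>card Q = card P\<close> show ?thesis by simp
qed simp

lemma indep_domatic_number_le_k_domatic_number: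
  assumes "finite (verts G)" "verts G \<noteq> {}" "k \<ge> 1"
  shows "indep_domatic_number k G \<le> k_domatic_number k G"
proof -
  let ?C = "{card P | P. disjoint P \<and> (\<forall>S\<in>P. indep_k_dominating k G S)}"
  have "finite ?C"
    using assms(1) by (rule finite_card_families) (auto simp: indep_k_dominating_def k_dominating_def)
  \<comment> \<open>The empty family qualifies, so the \<open>Max\<close> is over a nonempty
    set.\<close>
  moreover have "?C \<noteq> {}" by (auto intro: exI[of _ "{}"])
  moreover have "c \<le> k_domatic_number k G" if "c \<in> ?C" for c
    using that assms disjoint_card_le_k_domatic_number[of G k]
    by (auto simp: indep_k_dominating_def)
  ultimately show ?thesis unfolding indep_domatic_number_def by simp
qed

section \<open>Latin square graphs and transversals\<close>

lemma verts_latin_square_graph [simp]: "verts (latin_square_graph L n) = {1..n} \<times> {1..n}"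
  by (simp add: latin_square_graph_def)

lemma edge_latin_square_graph_iff:
  "{u, v} \<in> edges (latin_square_graph L n) \<longleftrightarrow>
     u \<in> {1..n} \<times> {1..n} \<and> v \<in> {1..n} \<times> {1..n} \<and> u \<noteq> v \<and>
     (fst u = fst v \<or> snd u = snd v \<or> L (fst u) (snd u) = L (fst v) (snd v))"
  by (cases u; cases v) (auto simp: latin_square_graph_def doubleton_eq_iff)

text \<open>Distinct cells of the grid are adjacent exactly when they agree in row, column or
  symbol, so the absence of edges amounts to injectivity of these three maps.\<close>

lemma independent_latin_square_graph_iff:
  "independent_set (latin_square_graph L n) S \<longleftrightarrow>
     S \<subseteq> {1..n} \<times> {1..n} \<and> inj_on fst S \<and> inj_on snd S \<and> inj_on (\<lambda>c. L (fst c) (snd c)) S"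
  unfolding independent_set_def edge_latin_square_graph_iff verts_latin_square_graph inj_on_def
  by blast

lemma transversal_iff_bij_betw:
  assumes "latin_square n L"
  shows "transversal n L T \<longleftrightarrow>
     T \<subseteq> {1..n} \<times> {1..n} \<and> bij_betw fst T {1..n} \<and> bij_betw snd T {1..n} \<and>
     bij_betw (\<lambda>c. L (fst c) (snd c)) T {1..n}"
\<comment> \<open>Both sides fail if \<open>T\<close> leaves the grid. Inside it, all three maps go
  into \<open>{1..n}\<close>, the symbol map because \<open>L\<close> takes its values there, and
  unique fibres become bijections.\<close>
proof (cases "T \<subseteq> {1..n} \<times> {1..n}")
  case True
  then have "fst ` T \<subseteq> {1..n}" "snd ` T \<subseteq> {1..n}" by auto
  moreover have "(\<lambda>c. L (fst c) (snd c)) ` T \<subseteq> {1..n}"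
    using True assms unfolding latin_square_def by fastforce
  ultimately show ?thesis
    using True by (simp only: transversal_def ex1_fibre_iff_bij_betw)
qed (simp add: transversal_def)

lemma card_transversal:
  assumes "transversal n L T"
  shows "finite T" "card T = n"
proof -
  have "T \<subseteq> {1..n} \<times> {1..n}" using assms by (simp add: transversal_def)
  then show "finite T" using finite_subset by blast
  have "fst ` T \<subseteq> {1..n}" using \<open>T \<subseteq> _\<close> by auto
  from ex1_fibre_iff_bij_betw[OF this] assms have "bij_betw fst T {1..n}"
    by (simp only: transversal_def)
  then show "card T = n" using bij_betw_same_card[of fst T "{1..n}"] by simp
qed

lemma transversal_indep_3_dominating:
  assumes lat: "latin_square n L" and T: "transversal n L T"
  shows "indep_k_dominating 3 (latin_square_graph L n) T"
proof -
  note bij = T[unfolded transversal_iff_bij_betw[OF lat]]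
  have sub: "T \<subseteq> {1..n} \<times> {1..n}" using bij by blast
  have "independent_set (latin_square_graph L n) T"
    using bij by (auto simp: independent_latin_square_graph_iff bij_betw_def)
  moreover have "k_dominating 3 (latin_square_graph L n) T"
    unfolding k_dominating_def
  proof (intro conjI ballI)
    fix v assume "v \<in> verts (latin_square_graph L n) - T"
    then have v: "fst v \<in> {1..n}" "snd v \<in> {1..n}" "v \<in> {1..n} \<times> {1..n}" "v \<notin> T" by auto
    have Lv: "L (fst v) (snd v) \<in> {1..n}" using lat v unfolding latin_square_def by blast
    obtain r where r: "r \<in> T" "fst r = fst v"
      using T v unfolding transversal_def by metis
    obtain c where c: "c \<in> T" "snd c = snd v"
      using T v unfolding transversal_def by metis
    obtain s where s: "s \<in> T" "L (fst s) (snd s) = L (fst v) (snd v)"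
      using T Lv unfolding transversal_def by metis
    have s_in: "fst s \<in> {1..n}" "snd s \<in> {1..n}" using s(1) sub by auto
    \<comment> \<open>A common cell would share row and column with \<open>v\<close>, hence be
      \<open>v\<close>, which lies outside \<open>T\<close>.\<close>
    have "r \<noteq> c" using r c v(4) by (metis prod_eqI)
    \<comment> \<open>Otherwise \<open>s\<close> lies in the row of \<open>v\<close> and carries its
      symbol; injectivity of the row makes it \<open>v\<close>. Columns give
      \<open>c \<noteq> s\<close> in the same way.\<close>
    have "r \<noteq> s"
    proof
      assume "r = s"
      then have "snd s = snd v"
        using lat v s s_in r unfolding latin_square_def by (metis inj_onD)
      then show False using r s \<open>r = s\<close> v(4) by (metis prod_eqI)
    qed
    have "c \<noteq> s"
    proof
      assume "c = s"
      then have "fst s = fst v"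
        using lat v s s_in c unfolding latin_square_def by (metis inj_onD)
      then show False using c s \<open>c = s\<close> v(4) by (metis prod_eqI)
    qed
    have "3 = card {r, c, s}" using \<open>r \<noteq> c\<close> \<open>r \<noteq> s\<close> \<open>c \<noteq> s\<close> by simp
    also have "\<dots> \<le> card {u \<in> T. {u, v} \<in> edges (latin_square_graph L n)}"
    proof (rule card_mono)
      show "finite {u \<in> T. {u, v} \<in> edges (latin_square_graph L n)}"
        using card_transversal(1)[OF T] by simp
      show "{r, c, s} \<subseteq> {u \<in> T. {u, v} \<in> edges (latin_square_graph L n)}"
        using r c s v(3,4) sub by (auto simp: edge_latin_square_graph_iff)
    qed
    finally show "3 \<le> card {u \<in> T. {u, v} \<in> edges (latin_square_graph L n)}" .
  qed (use sub in simp)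
  ultimately show ?thesis by (simp add: indep_k_dominating_def)
qed

lemma indep_k_dominating_transversal:
  assumes lat: "latin_square n L" and num: "k_domination_number k (latin_square_graph L n) = n"
    and S: "indep_k_dominating k (latin_square_graph L n) S"
  shows "transversal n L S"
proof -
  have dom: "k_dominating k (latin_square_graph L n) S"
    and ind: "S \<subseteq> {1..n} \<times> {1..n}" "inj_on fst S" "inj_on snd S"
      "inj_on (\<lambda>c. L (fst c) (snd c)) S"
    using S by (auto simp: indep_k_dominating_def independent_latin_square_graph_iff)
  have card: "n \<le> card S"
    using k_domination_number_le[OF _ dom] num by simp
  \<comment> \<open>An injective image of \<open>S\<close> has at least \<open>n\<close> elements,
    so inside \<open>{1..n}\<close> it is everything.\<close>
  have bij: "bij_betw f S {1..n}" if "inj_on f S" "f ` S \<subseteq> {1..n}" for f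
  proof -
    have "card {1..n} \<le> card (f ` S)" using that card by (simp add: card_image)
    with that show ?thesis by (simp add: bij_betw_def card_seteq)
  qed
  have "(\<lambda>c. L (fst c) (snd c)) ` S \<subseteq> {1..n}"
    using ind(1) lat unfolding latin_square_def by fastforce
  moreover have "fst ` S \<subseteq> {1..n}" "snd ` S \<subseteq> {1..n}" using ind(1) by auto
  ultimately show ?thesis
    unfolding transversal_iff_bij_betw[OF lat] using ind by (intro conjI bij)
qed

section \<open>Comparison of the maxima, and the case of a full partition\<close>

theorem theorem2p2:
  fixes L :: "nat \<Rightarrow> nat \<Rightarrow> nat" and n :: nat
  assumes "n \<ge> 1"
    and "latin_square n L"
    and "k_domination_number 3 (latin_square_graph L n) = n"
  shows "k_domatic_number 3 (latin_square_graph L n)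
           \<ge> indep_domatic_number 3 (latin_square_graph L n)
       \<and> indep_domatic_number 3 (latin_square_graph L n) = max_disjoint_transversals n L
       \<and> ((\<exists>P. indep_domatic_partition 3 (latin_square_graph L n) P) \<longrightarrow>
            k_domatic_number 3 (latin_square_graph L n)
              \<ge> indep_domatic_number_part 3 (latin_square_graph L n)
          \<and> indep_domatic_number_part 3 (latin_square_graph L n)
              = max_disjoint_transversals n L)"
proof -
  let ?G = "latin_square_graph L n"
  have fin: "finite (verts ?G)" and ne: "verts ?G \<noteq> {}" using assms(1) by auto
  have eq: "indep_k_dominating 3 ?G S \<longleftrightarrow> transversal n L S" for S
    using indep_k_dominating_transversal[OF assms(2,3)] transversal_indep_3_dominating[OF assms(2)]
    by blast
  have le: "indep_domatic_number 3 ?G \<le> k_domatic_number 3 ?G"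
    using fin ne by (intro indep_domatic_number_le_k_domatic_number) auto
  \<comment> \<open>By \<open>eq\<close>, both maxima range over the same families.\<close>
  have tau: "indep_domatic_number 3 ?G = max_disjoint_transversals n L"
    unfolding indep_domatic_number_def max_disjoint_transversals_def eq ..
  \<comment> \<open>Both sides equal \<open>n\<close>: transversals have \<open>n\<close> cells
    each, so exactly \<open>n\<close> of them tile the grid, and no disjoint family can be
    larger.\<close>
  have "indep_domatic_number_part 3 ?G = max_disjoint_transversals n L"
    if "indep_domatic_partition 3 ?G P" for P
  proof -
    have cardU: "card (\<Union>Q) = card Q * n" if "disjoint Q" "\<forall>T\<in>Q. transversal n L T" for Q
      using that card_transversal by (intro card_disjoint_uniform) auto
    have part: "disjoint Q" "\<forall>T\<in>Q. transversal n L T" "card Q = n"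
      if "indep_domatic_partition 3 ?G Q" for Q
    proof -
      show "disjoint Q" "\<forall>T\<in>Q. transversal n L T"
        using that by (auto simp: indep_domatic_partition_def partition_on_def eq)
      moreover have "\<Union>Q = {1..n} \<times> {1..n}"
        using that by (auto simp: indep_domatic_partition_def partition_on_def)
      ultimately have "n * n = card Q * n" using cardU[of Q] by simp
      then show "card Q = n" using assms(1) by simp
    qed
    \<comment> \<open>The given \<open>P\<close> makes this set nonempty.\<close>
    have "{card Q | Q. indep_domatic_partition 3 ?G Q} = {n}" using that part(3) by auto
    then have "indep_domatic_number_part 3 ?G = n" by (simp add: indep_domatic_number_part_def)
    moreover have "max_disjoint_transversals n L = n"
      unfolding max_disjoint_transversals_def
    proof (rule Max_eqI)
      show "finite {card Q | Q. disjoint Q \<and> (\<forall>T\<in>Q. transversal n L T)}"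
        using fin by (rule finite_card_families) (auto simp: transversal_def)
      show "n \<in> {card Q | Q. disjoint Q \<and> (\<forall>T\<in>Q. transversal n L T)}"
        using part[OF that] by blast
      \<comment> \<open>A disjoint family occupies \<open>card Q * n\<close> of the
        \<open>n * n\<close> cells; \<open>n \<ge> 1\<close> allows cancelling.\<close>
      fix c assume "c \<in> {card Q | Q. disjoint Q \<and> (\<forall>T\<in>Q. transversal n L T)}"
      then obtain Q where Q: "c = card Q" "disjoint Q" "\<forall>T\<in>Q. transversal n L T" by blast
      then have "\<Union>Q \<subseteq> {1..n} \<times> {1..n}" by (auto simp: transversal_def)
      then have "card (\<Union>Q) \<le> card ({1..n} \<times> {1..n})" by (intro card_mono) auto
      then have "card Q * n \<le> n * n" using cardU Q by simp
      then show "c \<le> n" using Q(1) assms(1) by simp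
    qed
    ultimately show ?thesis by simp
  qed
  with le tau show ?thesis by auto
qed

end
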